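(* Let $p,q>0$ and $r,t\ge 0$. The map $\Psi_{p,q;r,t}$ is positive if and only if \[ r^2\le pq,\qquad t^2\le pq . \] Inside this positivity region, \[ \Psi_{p,q;r,t}\text{ is decomposable}\iff r^2+t^2\le pq , \] and if $r^2+t^2>pq$, the map is atomic. Moreover, inside the positivity region, $2$-positivity of $\Psi_{p,q;r,t}$ is equivalent to complete positivity and to $t=0$, while $2$-copositivity is equivalent to complete copositivity and to $r=0$. For $r,t>0$ the kernel of $\Psi_{p,q;r,t}$ is of smooth conic normal form: it is a three dimensional subspace of $M_3(\mathbb C)$ contained in a $2\times2$ compression $U\otimes V\simeq M_2(\mathbb C)$, equivalent there to the traceless hyperplane of $M_2(\mathbb C)$, and its scheme of rank one matrices $\mathbb P(\ker\Psi_{p,q;r,t})\cap\Sigma_{3,3}$ is a smooth conic.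
   Context: For $p,q>0$ and $r,t\ge0$, $\Psi_{p,q;r,t}:M_3(\mathbb C)\to M_3(\mathbb C)$ is the linear map \[ \Psi_{p,q;r,t}(X)=\begin{pmatrix} p(x_{11}+x_{22})&0&r x_{13}\\ 0&p(x_{11}+x_{22})&t x_{32}\\ r x_{31}&t x_{23}&q x_{33}\end{pmatrix},\qquad X=(x_{ij}). \] A linear map $\Phi$ is positive if it sends positive semidefinite matrices to positive semidefinite matrices, $k$-positive if $\operatorname{id}_{M_k}\otimes\Phi$ is positive, completely positive if $k$-positive for all $k$. With $\mathsf T$ the transposition in the standard basis, $\Phi$ is $k$-copositive (resp. completely copositive) if $\mathsf T\circ\Phi$ is $k$-positive (resp. completely positive). $\Phi$ is decomposable if it is a sum of a completely positive and a completely copositive map. A positive map is atomic if it cannot be written as a sum of a $2$-positive and a $2$-copositive map. $\Sigma_{3,3}\subset\mathbb P(M_3)$ is the Segre variety of rank one matrices, with scheme structure given by the $2\times2$ minors. $M_3$ is identified with $\mathbb C^3\otimes\mathbb C^3$; a $2\times2$ compression is $U\otimes V$ with $U,V\subset\mathbb C^3$ of dimension two, and equivalence in it is under $\mathrm{GL}(U)\times\mathrm{GL}(V)$. *)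

theory Defs
  imports "HOL-Analysis.Analysis" "HOL-Library.Poly_Mapping" "HOL-Library.Nonpos_Ints"
begin

section \<open>Complex matrices as a complex vector space\<close>

definition cscale :: "complex \<Rightarrow> complex^'n^'m \<Rightarrow> complex^'n^'m" where
  "cscale c A = (\<chi> i j. c * A $ i $ j)"

global_interpretation cmat: vector_space "cscale :: complex \<Rightarrow> complex^'n^'m \<Rightarrow> complex^'n^'m"
  by unfold_locales (simp_all add: cscale_def vec_eq_iff algebra_simps)

abbreviation clinear_map :: "(complex^'n^'n \<Rightarrow> complex^'m^'m) \<Rightarrow> bool" where
  "clinear_map \<equiv> Vector_Spaces.linear cscale cscale"

section \<open>Positivity notions for maps between matrix algebras\<close>

text \<open>Over the complex numbers a matrix whose quadratic form takes only nonnegative real values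
  is automatically Hermitian.\<close>

definition psd :: "complex^'n^'n \<Rightarrow> bool" where
  "psd A \<longleftrightarrow> (\<forall>v. (\<Sum>i\<in>UNIV. cnj (v $ i) * (A *v v) $ i) \<in> \<real>\<^sub>\<ge>\<^sub>0)"

text \<open>An element of the tensor product of the k-by-k matrices with the n-by-n matrices is a k-by-k
  block matrix, given here by its blocks \<open>X a b\<close> with \<open>a, b < k\<close>; the values at other
  indices are irrelevant. It acts on k-tuples of vectors, and the identity tensored with \<open>\<Phi>\<close>
  applies \<open>\<Phi>\<close> to every block.\<close>

definition block_psd :: "nat \<Rightarrow> (nat \<Rightarrow> nat \<Rightarrow> complex^'n^'n) \<Rightarrow> bool" where
  "block_psd k X \<longleftrightarrow>
     (\<forall>v :: nat \<Rightarrow> complex^'n.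
        (\<Sum>a<k. \<Sum>b<k. \<Sum>i\<in>UNIV. cnj (v a $ i) * (X a b *v v b) $ i) \<in> \<real>\<^sub>\<ge>\<^sub>0)"

definition amplify ::
  "(complex^'n^'n \<Rightarrow> complex^'m^'m) \<Rightarrow> (nat \<Rightarrow> nat \<Rightarrow> complex^'n^'n) \<Rightarrow> (nat \<Rightarrow> nat \<Rightarrow> complex^'m^'m)"
  where "amplify \<Phi> X = (\<lambda>a b. \<Phi> (X a b))"

text \<open>The predicates below do not include linearity of the map; it is required separately wherever
  maps are quantified over.\<close>

definition positive_map :: "(complex^'n^'n \<Rightarrow> complex^'m^'m) \<Rightarrow> bool" where
  "positive_map \<Phi> \<longleftrightarrow> (\<forall>X. psd X \<longrightarrow> psd (\<Phi> X))"

definition k_positive :: "nat \<Rightarrow> (complex^'n^'n \<Rightarrow> complex^'m^'m) \<Rightarrow> bool" where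
  "k_positive k \<Phi> \<longleftrightarrow> (\<forall>X. block_psd k X \<longrightarrow> block_psd k (amplify \<Phi> X))"

definition completely_positive :: "(complex^'n^'n \<Rightarrow> complex^'m^'m) \<Rightarrow> bool" where
  "completely_positive \<Phi> \<longleftrightarrow> (\<forall>k. k_positive k \<Phi>)"

definition k_copositive :: "nat \<Rightarrow> (complex^'n^'n \<Rightarrow> complex^'m^'m) \<Rightarrow> bool" where
  "k_copositive k \<Phi> \<longleftrightarrow> k_positive k (transpose \<circ> \<Phi>)"

definition completely_copositive :: "(complex^'n^'n \<Rightarrow> complex^'m^'m) \<Rightarrow> bool" where
  "completely_copositive \<Phi> \<longleftrightarrow> completely_positive (transpose \<circ> \<Phi>)"

definition decomposable :: "(complex^'n^'n \<Rightarrow> complex^'m^'m) \<Rightarrow> bool" where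
  "decomposable \<Phi> \<longleftrightarrow>
     (\<exists>\<Phi>1 \<Phi>2. clinear_map \<Phi>1 \<and> clinear_map \<Phi>2 \<and>
        completely_positive \<Phi>1 \<and> completely_copositive \<Phi>2 \<and> \<Phi> = (\<lambda>X. \<Phi>1 X + \<Phi>2 X))"

definition atomic_map :: "(complex^'n^'n \<Rightarrow> complex^'m^'m) \<Rightarrow> bool" where
  "atomic_map \<Phi> \<longleftrightarrow> positive_map \<Phi> \<and>
     \<not> (\<exists>\<Phi>1 \<Phi>2. clinear_map \<Phi>1 \<and> clinear_map \<Phi>2 \<and>
          k_positive 2 \<Phi>1 \<and> k_copositive 2 \<Phi>2 \<and> \<Phi> = (\<lambda>X. \<Phi>1 X + \<Phi>2 X))"

section \<open>The family of maps\<close>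

definition Psi :: "real \<Rightarrow> real \<Rightarrow> real \<Rightarrow> real \<Rightarrow> complex^3^3 \<Rightarrow> complex^3^3" where
  "Psi p q r t X = vector [
     vector [of_real p * (X$1$1 + X$2$2), 0,                           of_real r * X$1$3],
     vector [0,                           of_real p * (X$1$1 + X$2$2), of_real t * X$3$2],
     vector [of_real r * X$3$1,           of_real t * X$2$3,           of_real q * X$3$3]]"

lemma clinear_map_Psi: "clinear_map (Psi p q r t)"
  by unfold_locales
     (simp_all add: Psi_def cscale_def vec_eq_iff forall_3 algebra_simps)

definition map_kernel :: "(complex^'n^'n \<Rightarrow> complex^'m^'m) \<Rightarrow> (complex^'n^'n) set" where
  "map_kernel \<Phi> = {X. \<Phi> X = 0}"

section \<open>Compressions and the traceless hyperplane\<close>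

text \<open>Matrices are identified with tensors by sending a pure tensor of u and v to \<open>u v\<^sup>T\<close>
  (no conjugation).\<close>

definition pure_tensor :: "complex^'m \<Rightarrow> complex^'n \<Rightarrow> complex^'n^'m" where
  "pure_tensor u v = (\<chi> i j. u $ i * v $ j)"

definition tensor_space :: "(complex^'m) set \<Rightarrow> (complex^'n) set \<Rightarrow> (complex^'n^'m) set" where
  "tensor_space U V = cmat.span {pure_tensor u v | u v. u \<in> U \<and> v \<in> V}"

text \<open>The columns of \<open>P\<close> form a basis of the plane \<open>U\<close>.\<close>

definition frame_of :: "complex^2^'n \<Rightarrow> (complex^'n) set \<Rightarrow> bool" where
  "frame_of P U \<longleftrightarrow> inj ((*v) P) \<and> range ((*v) P) = U"

text \<open>Bases \<open>P\<close> of \<open>U\<close> and \<open>Q\<close> of \<open>V\<close> identify the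
  two-by-two matrices with \<open>tensor_space U V\<close> via \<open>Z \<mapsto> P Z Q\<^sup>T\<close>.
  In these coordinates \<open>GL(U) \<times> GL(V)\<close> acts by \<open>Z \<mapsto> A Z B\<^sup>T\<close>.
  The condition asks that, for each such identification, \<open>K\<close> lies in the orbit of the
  traceless hyperplane.\<close>

definition equiv_traceless ::
  "(complex^'m) set \<Rightarrow> (complex^'n) set \<Rightarrow> (complex^'n^'m) set \<Rightarrow> bool" where
  "equiv_traceless U V K \<longleftrightarrow>
     (\<forall>P Q. frame_of P U \<and> frame_of Q V \<longrightarrow>
       (\<exists>A B :: complex^2^2. invertible A \<and> invertible B \<and>
          K = (\<lambda>Z. P ** (A ** Z ** transpose B) ** transpose Q) ` {Z. trace Z = 0}))"

section \<open>Polynomials in the matrix entries\<close>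

text \<open>The homogeneous coordinate ring of the projective space of three-by-three matrices, as
  finitely supported functions from exponent vectors to coefficients.\<close>

type_synonym mpoly33 = "((3 \<times> 3) \<Rightarrow>\<^sub>0 nat) \<Rightarrow>\<^sub>0 complex"

definition entry_var :: "3 \<Rightarrow> 3 \<Rightarrow> mpoly33" where
  "entry_var i j = Poly_Mapping.single (Poly_Mapping.single (i, j) 1) 1"

definition mono_degree :: "((3 \<times> 3) \<Rightarrow>\<^sub>0 nat) \<Rightarrow> nat" where
  "mono_degree m = (\<Sum>v\<in>UNIV. Poly_Mapping.lookup m v)"

definition homogeneous :: "nat \<Rightarrow> mpoly33 \<Rightarrow> bool" where
  "homogeneous d f \<longleftrightarrow> (\<forall>m\<in>Poly_Mapping.keys f. mono_degree m = d)"

definition eval_at :: "mpoly33 \<Rightarrow> complex^3^3 \<Rightarrow> complex" where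
  "eval_at f x = (\<Sum>m\<in>Poly_Mapping.keys f.
      Poly_Mapping.lookup f m * (\<Prod>(i, j)\<in>UNIV. (x $ i $ j) ^ Poly_Mapping.lookup m (i, j)))"

text \<open>For exponents not involving the variable the subtraction below truncates, but then the
  coefficient vanishes.\<close>

definition partial_deriv :: "3 \<Rightarrow> 3 \<Rightarrow> mpoly33 \<Rightarrow> mpoly33" where
  "partial_deriv i j f = (\<Sum>m\<in>Poly_Mapping.keys f.
      Poly_Mapping.single (m - Poly_Mapping.single (i, j) 1)
        (of_nat (Poly_Mapping.lookup m (i, j)) * Poly_Mapping.lookup f m))"

definition ideal_generated :: "mpoly33 set \<Rightarrow> mpoly33 set" where
  "ideal_generated S = module.span (*) S"

section \<open>Closed subschemes of projective space\<close>

text \<open>A closed subscheme of the projective space of three-by-three matrices is given by a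
  homogeneous ideal. Two homogeneous ideals define the same subscheme iff their saturations with
  respect to the irrelevant ideal agree.\<close>

definition saturation :: "mpoly33 set \<Rightarrow> mpoly33 set" where
  "saturation I = {f. \<exists>d. \<forall>m. mono_degree m = d \<longrightarrow> Poly_Mapping.single m 1 * f \<in> I}"

definition same_subscheme :: "mpoly33 set \<Rightarrow> mpoly33 set \<Rightarrow> bool" where
  "same_subscheme I J \<longleftrightarrow> saturation I = saturation J"

definition segre_minors :: "mpoly33 set" where
  "segre_minors =
     {entry_var i j * entry_var k l - entry_var i l * entry_var k j | i j k l. True}"

definition vanishing_linear_forms :: "(complex^3^3) set \<Rightarrow> mpoly33 set" where
  "vanishing_linear_forms K = {f. homogeneous 1 f \<and> (\<forall>x\<in>K. eval_at f x = 0)}"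

text \<open>The scheme-theoretic intersection of \<open>\<P>(K)\<close> with the Segre variety: the sum of the two
  ideals.\<close>

definition rank_one_scheme :: "(complex^3^3) set \<Rightarrow> mpoly33 set" where
  "rank_one_scheme K = ideal_generated (vanishing_linear_forms K \<union> segre_minors)"

text \<open>A smooth conic is cut out in a projective plane \<open>\<P>(W)\<close> by a quadratic form \<open>F\<close> whose
  differential along \<open>W\<close> does not vanish at any zero of \<open>F\<close> in \<open>\<P>(W)\<close>
  (in particular \<open>F\<close> does not vanish identically on \<open>W\<close>).\<close>

definition smooth_conic :: "mpoly33 set \<Rightarrow> bool" where
  "smooth_conic I \<longleftrightarrow>
     (\<exists>W F. cmat.subspace W \<and> cmat.dim W = 3 \<and> homogeneous 2 F \<and>
        same_subscheme I (ideal_generated (vanishing_linear_forms W \<union> {F})) \<and>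
        (\<forall>x\<in>W. x \<noteq> 0 \<and> eval_at F x = 0 \<longrightarrow>
           (\<exists>w\<in>W. (\<Sum>i\<in>UNIV. \<Sum>j\<in>UNIV. eval_at (partial_deriv i j F) x * w $ i $ j) \<noteq> 0)))"

end

theory Submission
  imports Defs
begin

text \<open>Everything about positivity comes down to how the entry \<open>q\<close> at \<open>(3, 3)\<close> is shared.

For positivity there is no competition: on a positive matrix with diagonal \<open>a, b, c\<close> the cross terms
with \<open>r\<close> and \<open>t\<close> are controlled by \<open>a c\<close> and \<open>b c\<close> respectively, while the diagonal provides
\<open>p (a + b)\<close> in both places. Hence \<open>r\<^sup>2 \<le> p q\<close> and \<open>t\<^sup>2 \<le> p q\<close> suffice, and rank one matrices
show that they are necessary (\<open>Psi_positive\<close>, \<open>Psi_positive_bounds\<close>).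

A sum of a two-positive and a two-copositive map has to pay twice. Applied to the block matrix formed
by the matrix units \<open>E\<^sub>i\<^sub>i, E\<^sub>i\<^sub>j, E\<^sub>j\<^sub>i, E\<^sub>j\<^sub>j\<close>, two-positivity gives a Cauchy--Schwarz bound on the
entries of the image of \<open>E\<^sub>i\<^sub>j\<close>, and two-copositivity gives the transposed bound. Zeros on the
diagonal force the entry \<open>r\<close> into the two-positive summand and \<open>t\<close> into the two-copositive one.
If their shares of \<open>q\<close> are \<open>q\<^sub>1\<close> and \<open>q\<^sub>2\<close>, then \<open>r\<^sup>2 \<le> p q\<^sub>1\<close> and \<open>t\<^sup>2 \<le> p q\<^sub>2\<close>, and these add up
to \<open>r\<^sup>2 + t\<^sup>2 \<le> p q\<close> (\<open>Psi_two_decomposition_bounds\<close>). A zero summand has a zero share, which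
gives the criteria \<open>t = 0\<close> and \<open>r = 0\<close>. Conversely, an explicit sum of maps \<open>X \<mapsto> K X K\<^sup>*\<close>, partly
transposed, realizes the optimal shares \<open>r\<^sup>2 / p\<close> and \<open>t\<^sup>2 / p\<close> (\<open>Psi_split\<close>).

For \<open>r, t > 0\<close> the kernel consists of the traceless matrices in the upper left two-by-two corner.
The linear forms vanishing on it kill all two-by-two minors except the corner determinant, so the
rank one scheme is the conic cut out by the determinant on traceless matrices, a nondegenerate
quadratic form (\<open>rank_one_scheme_corner\<close>, \<open>smooth_conic_corner\<close>).\<close>

section \<open>Entries of positive block matrices\<close>

text \<open>The scalar core of every estimate below: a two-by-two form with values in the nonnegative reals has
nonnegative diagonal, is Hermitian and satisfies the Cauchy--Schwarz inequality.\<close>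

lemma nonneg_hermitian_form:
  fixes A B C D :: complex
  assumes "\<And>x y. cnj x * A * x + cnj x * B * y + cnj y * C * x + cnj y * D * y \<in> \<real>\<^sub>\<ge>\<^sub>0"
  shows "Im A = 0" "0 \<le> Re A" "Im D = 0" "0 \<le> Re D"
    "C = cnj B" "(cmod B)\<^sup>2 \<le> Re A * Re D"
proof -
  have A: "A \<in> \<real>\<^sub>\<ge>\<^sub>0" using assms[of 1 0] by simp
  have D: "D \<in> \<real>\<^sub>\<ge>\<^sub>0" using assms[of 0 1] by simp
  have A': "Im A = 0" "0 \<le> Re A" and D': "Im D = 0" "0 \<le> Re D"
    using A D by (auto simp: complex_nonneg_Reals_iff)
  show "Im A = 0" "0 \<le> Re A" "Im D = 0" "0 \<le> Re D"
    using A' D' by auto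
  have "Im B + Im C = 0" "Re B - Re C = 0"
    using assms[of 1 1] assms[of 1 \<i>] A' D' by (auto simp: complex_nonneg_Reals_iff)
  then show C: "C = cnj B" by (simp add: complex_eq_iff)
  define b where "b = (cmod B)\<^sup>2"
  have b0: "0 \<le> b" by (simp add: b_def)
  \<comment> \<open>Along \<open>x = s B\<close>, \<open>y = 1\<close> with real \<open>s\<close> the off-diagonal part becomes real, and the form is a
    real quadratic polynomial in \<open>s\<close>; for \<open>A > 0\<close> its minimum at \<open>s = -1 / A\<close> gives the inequality.\<close>
  have key: "0 \<le> s\<^sup>2 * Re A * b + 2 * s * b + Re D" for s :: real
  proof -
    have bb: "B * cnj B = of_real b" by (simp only: b_def complex_norm_square)
    have E: "cnj (s * B) * A * (s * B) + cnj (s * B) * B * 1 + cnj 1 * C * (s * B) + cnj 1 * D * 1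
        = s\<^sup>2 * A * b + 2 * s * b + D"
    proof -
      have "cnj (s * B) * A * (s * B) + cnj (s * B) * B * 1 + cnj 1 * C * (s * B) + cnj 1 * D * 1
        = s\<^sup>2 * A * (B * cnj B) + 2 * s * (B * cnj B) + D"
        by (simp add: C power2_eq_square algebra_simps)
      then show ?thesis by (simp only: bb of_real_mult)
    qed
    have "s\<^sup>2 * A * b + 2 * s * b + D \<in> \<real>\<^sub>\<ge>\<^sub>0"
      using assms[of "s * B" 1] by (simp only: E)
    then show ?thesis by (simp add: complex_nonneg_Reals_iff power2_eq_square A')
  qed
  show "(cmod B)\<^sup>2 \<le> Re A * Re D"
  proof (cases "b = 0")
    case True
    then show ?thesis using A' D' by (simp add: b_def)
  next
    case False
    then have bpos: "b > 0" using b0 by simp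
    show ?thesis
    proof (cases "Re A = 0")
      case True
      \<comment> \<open>Without the quadratic term the polynomial is affine in \<open>s\<close> with slope \<open>2 b > 0\<close>; at this \<open>s\<close> its
        value is \<open>-1\<close>, which is impossible.\<close>
      then have "0 \<le> 2 * (-(Re D + 1) / (2 * b)) * b + Re D" using key[of "-(Re D + 1) / (2 * b)"] by simp
      then show ?thesis using bpos by (simp add: field_simps)
    next
      case False
      then have a: "Re A > 0" using A' by simp
      have "0 \<le> (- 1 / Re A)\<^sup>2 * Re A * b + 2 * (- 1 / Re A) * b + Re D" by (rule key)
      also have "\<dots> = (Re A * Re D - b) / Re A" using a by (simp add: field_simps power2_eq_square)
      finally show ?thesis using a by (simp add: zero_le_divide_iff b_def)
    qed
  qed
qed

text \<open>The form that defines block positivity, with its two arguments kept apart so that it can be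
expanded by sesquilinearity.\<close>

definition block_form :: "nat \<Rightarrow> (nat \<Rightarrow> nat \<Rightarrow> complex^'n^'n) \<Rightarrow> (nat \<Rightarrow> complex^'n) \<Rightarrow> (nat \<Rightarrow> complex^'n) \<Rightarrow> complex"
  where "block_form k X u v = (\<Sum>a<k. \<Sum>b<k. \<Sum>i\<in>UNIV. cnj (u a $ i) * (X a b *v v b) $ i)"

lemma block_psd_iff_form: "block_psd k X \<longleftrightarrow> (\<forall>v. block_form k X v v \<in> \<real>\<^sub>\<ge>\<^sub>0)"
  by (simp add: block_psd_def block_form_def)

lemma psd_iff_block_psd: "psd A \<longleftrightarrow> block_psd 1 (\<lambda>_ _. A)"
proof
  assume "psd A" then show "block_psd 1 (\<lambda>_ _. A)" by (simp add: psd_def block_psd_def)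
next
  assume *: "block_psd 1 (\<lambda>_ _. A)"
  show "psd A" unfolding psd_def
  proof
    fix v :: "complex^'a"
    from *[unfolded block_psd_def, THEN spec, of "\<lambda>_. v"]
    show "(\<Sum>i\<in>UNIV. cnj (v $ i) * (A *v v) $ i) \<in> \<real>\<^sub>\<ge>\<^sub>0" by simp
  qed
qed

lemma block_form_add_left:
  "block_form k X (\<lambda>a. u a + u' a) v = block_form k X u v + block_form k X u' v"
  by (simp add: block_form_def algebra_simps sum.distrib)

lemma block_form_add_right:
  "block_form k X u (\<lambda>a. v a + v' a) = block_form k X u v + block_form k X u v'"
  by (simp add: block_form_def algebra_simps sum.distrib matrix_vector_right_distrib)

lemma block_form_axis:
  assumes "a < k" "b < k"
  shows "block_form k X (\<lambda>c. if c = a then axis i x else 0) (\<lambda>c. if c = b then axis j y else 0)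
    = cnj x * X a b $ i $ j * y"
proof -
  have mv: "(X a b *v axis j y) $ i = X a b $ i $ j * y"
    by (simp add: matrix_vector_mult_def axis_def if_distrib cong: if_cong)
  have "(\<Sum>m\<in>UNIV. cnj ((if c = a then axis i x else 0) $ m) * (X c d *v (if d = b then axis j y else 0)) $ m)
      = (if c = a then if d = b then cnj x * X a b $ i $ j * y else 0 else 0)" for c d
  proof (cases "c = a \<and> d = b")
    case True
    have "(\<Sum>m\<in>UNIV. cnj (axis i x $ m) * (X a b *v axis j y) $ m)
        = (\<Sum>m\<in>UNIV. if m = i then cnj x * (X a b *v axis j y) $ i else 0)"
      by (rule sum.cong) (auto simp: axis_def)
    with True show ?thesis by (simp add: mv mult.assoc)
  qed auto
  then have "block_form k X (\<lambda>c. if c = a then axis i x else 0) (\<lambda>c. if c = b then axis j y else 0)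
    = (\<Sum>c<k. \<Sum>d<k. if c = a then if d = b then cnj x * X a b $ i $ j * y else 0 else 0)"
    by (simp only: block_form_def)
  also have "\<dots> = (\<Sum>c<k. if c = a then \<Sum>d<k. if d = b then cnj x * X a b $ i $ j * y else 0 else 0)"
    by (rule sum.cong) auto
  also have "\<dots> = cnj x * X a b $ i $ j * y" using assms by simp
  finally show ?thesis .
qed

text \<open>Evaluating the form on vectors supported at two coordinates only. These may coincide,
\<open>(a, i) = (b, j)\<close>, because the expansion uses sesquilinearity alone.\<close>

lemma block_psd_entries:
  fixes X :: "nat \<Rightarrow> nat \<Rightarrow> complex^'n^'n"
  assumes X: "block_psd k X" and ab: "a < k" "b < k"
  shows "Im (X a a $ i $ i) = 0" "0 \<le> Re (X a a $ i $ i)"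
    "X b a $ j $ i = cnj (X a b $ i $ j)"
    "(cmod (X a b $ i $ j))\<^sup>2 \<le> Re (X a a $ i $ i) * Re (X b b $ j $ j)"
proof -
  have "cnj x * X a a $ i $ i * x + cnj x * X a b $ i $ j * y
      + cnj y * X b a $ j $ i * x + cnj y * X b b $ j $ j * y \<in> \<real>\<^sub>\<ge>\<^sub>0" for x y
  proof -
    let ?v = "\<lambda>c. (if c = a then axis i x else 0) + (if c = b then axis j y else (0::complex^'n))"
    have "block_form k X ?v ?v \<in> \<real>\<^sub>\<ge>\<^sub>0" using X by (simp add: block_psd_iff_form)
    then show ?thesis
      by (simp only: block_form_add_left block_form_add_right block_form_axis ab add_ac)
  qed
  note * = nonneg_hermitian_form[OF this]
  show "Im (X a a $ i $ i) = 0" "0 \<le> Re (X a a $ i $ i)"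
    "X b a $ j $ i = cnj (X a b $ i $ j)"
    "(cmod (X a b $ i $ j))\<^sup>2 \<le> Re (X a a $ i $ i) * Re (X b b $ j $ j)"
    by (fact *)+
qed

lemma psd_entries:
  fixes A :: "complex^'n^'n"
  assumes "psd A"
  shows "Im (A $ i $ i) = 0" "0 \<le> Re (A $ i $ i)" "A $ j $ i = cnj (A $ i $ j)"
    "(cmod (A $ i $ j))\<^sup>2 \<le> Re (A $ i $ i) * Re (A $ j $ j)"
proof -
  have A: "block_psd 1 (\<lambda>_ _. A)" using assms by (simp only: psd_iff_block_psd)
  show "Im (A $ i $ i) = 0" "0 \<le> Re (A $ i $ i)" "A $ j $ i = cnj (A $ i $ j)"
    "(cmod (A $ i $ j))\<^sup>2 \<le> Re (A $ i $ i) * Re (A $ j $ j)"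
    by (rule block_psd_entries[OF A zero_less_one zero_less_one])+
qed

section \<open>Maps that are two-positive or two-copositive\<close>

definition matrix_unit :: "'n \<Rightarrow> 'n \<Rightarrow> complex^'n^'n" where
  "matrix_unit i j = (\<chi> k l. if k = i \<and> l = j then 1 else 0)"

text \<open>This block matrix is \<open>w w\<^sup>*\<close> for the vector \<open>w\<close> whose block \<open>a\<close> is the basis vector \<open>s a\<close>; the
number \<open>z\<close> in the proof is the inner product with \<open>w\<close>.\<close>

lemma block_psd_matrix_units: "block_psd k (\<lambda>a b. matrix_unit (s a) (s b) :: complex^'n^'n)"
  unfolding block_psd_def
proof
  fix v :: "nat \<Rightarrow> complex^'n"
  have mv: "(matrix_unit i j *v w) $ m = (if m = i then w $ j else 0)" for i j m and w :: "complex^'n"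
  proof (cases "m = i")
    case True
    then show ?thesis
      by (simp add: matrix_vector_mult_def matrix_unit_def if_distrib if_distribR cong: if_cong)
  qed (simp add: matrix_vector_mult_def matrix_unit_def)
  define z where "z = (\<Sum>b<k. v b $ s b)"
  have "(\<Sum>a<k. \<Sum>b<k. \<Sum>i\<in>UNIV. cnj (v a $ i) * (matrix_unit (s a) (s b) *v v b) $ i) = cnj z * z"
    by (simp add: mv z_def if_distrib sum_product cong: if_cong)
  also have "\<dots> = of_real ((cmod z)\<^sup>2)" by (simp only: complex_norm_square mult.commute)
  finally show "(\<Sum>a<k. \<Sum>b<k. \<Sum>i\<in>UNIV. cnj (v a $ i) * (matrix_unit (s a) (s b) *v v b) $ i) \<in> \<real>\<^sub>\<ge>\<^sub>0"
    by simp
qed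

text \<open>A two-positive map sends the positive block matrix with blocks \<open>E\<^sub>i\<^sub>i, E\<^sub>i\<^sub>j, E\<^sub>j\<^sub>i, E\<^sub>j\<^sub>j\<close> to a positive
one, and the entries of the image obey Cauchy--Schwarz.\<close>

lemma two_positive_entries:
  fixes \<Phi> :: "complex^'n^'n \<Rightarrow> complex^'m^'m"
  assumes "k_positive 2 \<Phi>"
  shows "0 \<le> Re (\<Phi> (matrix_unit i i) $ k $ k)"
    "(cmod (\<Phi> (matrix_unit i j) $ k $ l))\<^sup>2
       \<le> Re (\<Phi> (matrix_unit i i) $ k $ k) * Re (\<Phi> (matrix_unit j j) $ l $ l)"
proof -
  let ?s = "\<lambda>a::nat. if a = 0 then i else j"
  have "block_psd 2 (amplify \<Phi> (\<lambda>a b. matrix_unit (?s a) (?s b)))"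
    using assms[unfolded k_positive_def, THEN spec, THEN mp, OF block_psd_matrix_units[of 2 ?s]] .
  then have X: "block_psd 2 (\<lambda>a b. \<Phi> (matrix_unit (?s a) (?s b)))"
    by (simp only: amplify_def)
  show "0 \<le> Re (\<Phi> (matrix_unit i i) $ k $ k)"
    using block_psd_entries(2)[OF X, of 0 1] by simp
  show "(cmod (\<Phi> (matrix_unit i j) $ k $ l))\<^sup>2
       \<le> Re (\<Phi> (matrix_unit i i) $ k $ k) * Re (\<Phi> (matrix_unit j j) $ l $ l)"
    using block_psd_entries(4)[OF X, of 0 1] by simp
qed

text \<open>The bound of two-positive maps with the roles of \<open>k\<close> and \<open>l\<close> exchanged: it pairs the other two
diagonal entries. This difference is what separates the \<open>r\<close>-entries of \<open>Psi\<close> from its \<open>t\<close>-entries.\<close>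

lemma two_copositive_entries:
  fixes \<Phi> :: "complex^'n^'n \<Rightarrow> complex^'m^'m"
  assumes "k_copositive 2 \<Phi>"
  shows "0 \<le> Re (\<Phi> (matrix_unit i i) $ k $ k)"
    "(cmod (\<Phi> (matrix_unit i j) $ k $ l))\<^sup>2
       \<le> Re (\<Phi> (matrix_unit i i) $ l $ l) * Re (\<Phi> (matrix_unit j j) $ k $ k)"
proof -
  have T: "k_positive 2 (transpose \<circ> \<Phi>)" using assms by (simp only: k_copositive_def)
  show "0 \<le> Re (\<Phi> (matrix_unit i i) $ k $ k)"
    using two_positive_entries(1)[OF T, of i k] by (simp add: transpose_def)
  show "(cmod (\<Phi> (matrix_unit i j) $ k $ l))\<^sup>2
       \<le> Re (\<Phi> (matrix_unit i i) $ l $ l) * Re (\<Phi> (matrix_unit j j) $ k $ k)"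
    using two_positive_entries(2)[OF T, of i j l k] by (simp add: transpose_def)
qed

lemma Psi_matrix_units:
  "Psi p q r t (matrix_unit 1 1) $ 1 $ 1 = p" "Psi p q r t (matrix_unit 1 1) $ 3 $ 3 = 0"
  "Psi p q r t (matrix_unit 2 2) $ 2 $ 2 = p" "Psi p q r t (matrix_unit 2 2) $ 3 $ 3 = 0"
  "Psi p q r t (matrix_unit 3 3) $ 3 $ 3 = q"
  "Psi p q r t (matrix_unit 1 3) $ 1 $ 3 = r" "Psi p q r t (matrix_unit 3 2) $ 2 $ 3 = t"
  by (simp_all add: Psi_def matrix_unit_def)

text \<open>The central estimate. Diagonal entries of both summands at matrix units are nonnegative and add up
to those of \<open>Psi\<close>, so the vanishing \<open>(3, 3)\<close> entries of \<open>Psi\<close> at \<open>E\<^sub>1\<^sub>1\<close> and \<open>E\<^sub>2\<^sub>2\<close> vanish for each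
summand. Through the two Cauchy--Schwarz bounds this forces the entry \<open>r\<close> to come entirely from the
two-positive summand and the entry \<open>t\<close> entirely from the two-copositive one. Each of them then
consumes its own share of the entry \<open>q\<close>, which is the only entry they compete for.\<close>

lemma Psi_two_decomposition_bounds:
  assumes p: "p > 0"
    and \<Phi>: "k_positive 2 \<Phi>1" "k_copositive 2 \<Phi>2" "\<And>X. Psi p q r t X = \<Phi>1 X + \<Phi>2 X"
  shows "r\<^sup>2 \<le> p * Re (\<Phi>1 (matrix_unit 3 3) $ 3 $ 3)"
    "t\<^sup>2 \<le> p * Re (\<Phi>2 (matrix_unit 3 3) $ 3 $ 3)"
    "Re (\<Phi>1 (matrix_unit 3 3) $ 3 $ 3) + Re (\<Phi>2 (matrix_unit 3 3) $ 3 $ 3) = q"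
proof -
  note P1 = two_positive_entries[OF \<Phi>(1)] and P2 = two_copositive_entries[OF \<Phi>(2)]
  note U = Psi_matrix_units[of p q r t, unfolded \<Phi>(3) vector_add_component]
  from U(5) show "Re (\<Phi>1 (matrix_unit 3 3) $ 3 $ 3) + Re (\<Phi>2 (matrix_unit 3 3) $ 3 $ 3) = q"
    by (metis Re_complex_of_real plus_complex.sel(1))
  have le: "Re x \<le> c" if "x + y = complex_of_real c" "0 \<le> Re y" for x y c
    using that by (metis Re_complex_of_real plus_complex.sel(1) le_add_same_cancel1)
  have p1: "Re (\<Phi>1 (matrix_unit 1 1) $ 1 $ 1) \<le> p" using le[OF U(1)] P2(1) by blast
  have p2: "Re (\<Phi>2 (matrix_unit 2 2) $ 2 $ 2) \<le> p"
    using U(3) P1(1) le by (metis add.commute)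
  have "Re (\<Phi>2 (matrix_unit 1 1) $ 3 $ 3) \<le> 0" "Re (\<Phi>1 (matrix_unit 2 2) $ 3 $ 3) \<le> 0"
    using U(2,4) P1(1) P2(1) le[of _ _ 0] by (simp, metis add.commute, simp)
  then have z: "Re (\<Phi>2 (matrix_unit 1 1) $ 3 $ 3) = 0" "Re (\<Phi>1 (matrix_unit 2 2) $ 3 $ 3) = 0"
    using P1(1) P2(1) by (simp_all add: antisym)
  have "\<Phi>2 (matrix_unit 1 3) $ 1 $ 3 = 0" using P2(2)[of 1 3 1 3] z by simp
  then have r: "\<Phi>1 (matrix_unit 1 3) $ 1 $ 3 = r" using U(6) by simp
  have "\<Phi>1 (matrix_unit 3 2) $ 2 $ 3 = 0" using P1(2)[of 3 2 2 3] z by simp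
  then have t: "\<Phi>2 (matrix_unit 3 2) $ 2 $ 3 = t" using U(7) by simp
  have "r\<^sup>2 \<le> Re (\<Phi>1 (matrix_unit 1 1) $ 1 $ 1) * Re (\<Phi>1 (matrix_unit 3 3) $ 3 $ 3)"
    using P1(2)[of 1 3 1 3] r by simp
  also have "\<dots> \<le> p * Re (\<Phi>1 (matrix_unit 3 3) $ 3 $ 3)"
    using p1 P1(1) by (intro mult_right_mono)
  finally show "r\<^sup>2 \<le> p * Re (\<Phi>1 (matrix_unit 3 3) $ 3 $ 3)" .
  have "t\<^sup>2 \<le> Re (\<Phi>2 (matrix_unit 3 3) $ 3 $ 3) * Re (\<Phi>2 (matrix_unit 2 2) $ 2 $ 2)"
    using P2(2)[of 3 2 2 3] t by simp
  also have "\<dots> \<le> Re (\<Phi>2 (matrix_unit 3 3) $ 3 $ 3) * p"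
    using p2 P2(1) by (intro mult_left_mono)
  finally show "t\<^sup>2 \<le> p * Re (\<Phi>2 (matrix_unit 3 3) $ 3 $ 3)" by (simp add: mult.commute)
qed

section \<open>The positivity region\<close>

lemma Psi_quadratic_form:
  fixes v :: "complex^3"
  shows "(\<Sum>i\<in>UNIV. cnj (v $ i) * (Psi p q r t X *v v) $ i) =
    p * (X$1$1 + X$2$2) * (of_real ((cmod (v$1))\<^sup>2) + of_real ((cmod (v$2))\<^sup>2))
    + q * X$3$3 * of_real ((cmod (v$3))\<^sup>2)
    + (r * (cnj (v$1) * X$1$3 * v$3 + cnj (v$3) * X$3$1 * v$1)
       + t * (cnj (v$2) * X$3$2 * v$3 + cnj (v$3) * X$2$3 * v$2))"
  unfolding complex_norm_square
  by (simp add: Psi_def matrix_vector_mult_def sum_3 algebra_simps)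

text \<open>Entrywise Cauchy--Schwarz for \<open>X\<close> bounds the two cross terms of the quadratic form by
\<open>sqrt (p q) sqrt c z (x sqrt a + y sqrt b)\<close>, where \<open>a, b, c\<close> is the diagonal of \<open>X\<close> and \<open>x, y, z\<close> are the
moduli of the coordinates. A second Cauchy--Schwarz inequality, between \<open>(x, y)\<close> and
\<open>(sqrt a, sqrt b)\<close>, shows why \<open>r\<close> and \<open>t\<close> are bounded separately: both cross terms share the same
\<open>p (a + b) (x\<^sup>2 + y\<^sup>2)\<close>.\<close>

lemma Psi_positive:
  assumes p: "p > 0" and q: "q > 0" and r: "r \<ge> 0" and t: "t \<ge> 0"
    and rb: "r\<^sup>2 \<le> p * q" and tb: "t\<^sup>2 \<le> p * q"
  shows "positive_map (Psi p q r t)"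
  unfolding positive_map_def
proof (intro allI impI)
  fix X :: "complex^3^3"
  assume X: "psd X"
  note E = psd_entries[OF X]
  show "psd (Psi p q r t X)"
    unfolding psd_def Psi_quadratic_form
  proof
    fix v :: "complex^3"
    define a b c where abc: "a = Re (X$1$1)" "b = Re (X$2$2)" "c = Re (X$3$3)"
    define x y z where xyz: "x = cmod (v$1)" "y = cmod (v$2)" "z = cmod (v$3)"
    have X1: "X$1$1 = a" "X$2$2 = b" "X$3$3 = c" and abc0: "0 \<le> a" "0 \<le> b" "0 \<le> c"
      using E(1,2) by (simp_all add: abc complex_eq_iff)
    define u where "u = cnj (v$1) * X$1$3 * v$3"
    define w where "w = cnj (v$2) * X$3$2 * v$3"
    have u': "cnj (v$3) * X$3$1 * v$1 = cnj u" and w': "cnj (v$3) * X$2$3 * v$2 = cnj w"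
      using E(3)[of 3 1] E(3)[of 2 3] by (simp_all add: u_def w_def)
    have s: "r \<le> sqrt (p * q)" "t \<le> sqrt (p * q)" using rb tb by (simp_all add: real_le_rsqrt)
    have "cmod (X$1$3) \<le> sqrt (a * c)" "cmod (X$3$2) \<le> sqrt (b * c)"
      using E(4)[of 1 3] E(4)[of 3 2] by (auto intro!: real_le_rsqrt simp: abc mult.commute)
    then have "cmod u \<le> x * sqrt (a * c) * z" "cmod w \<le> y * sqrt (b * c) * z"
      by (auto simp: u_def w_def norm_mult xyz intro!: mult_mono mult_left_mono mult_right_mono)
    then have "r * cmod u \<le> sqrt (p * q) * (x * sqrt (a * c) * z)"
      "t * cmod w \<le> sqrt (p * q) * (y * sqrt (b * c) * z)"
      using s r t p q by (auto intro!: mult_mono)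
    then have "r * (- Re u) + t * (- Re w)
        \<le> sqrt (p * q) * (x * sqrt (a * c) * z) + sqrt (p * q) * (y * sqrt (b * c) * z)"
      using abs_Re_le_cmod[of u] abs_Re_le_cmod[of w] r t
      by (smt (verit) mult_left_mono)
    also have "\<dots> = sqrt (q * c) * z * (sqrt p * (x * sqrt a + y * sqrt b))"
      by (simp add: real_sqrt_mult algebra_simps)
    finally have 1: "r * (- Re u) + t * (- Re w) \<le> sqrt (q * c) * z * (sqrt p * (x * sqrt a + y * sqrt b))" .
    have "2 * (sqrt (q * c) * z * (sqrt p * (x * sqrt a + y * sqrt b)))
        \<le> (sqrt (q * c) * z)\<^sup>2 + (sqrt p * (x * sqrt a + y * sqrt b))\<^sup>2"
      using sum_squares_bound[of "sqrt (q * c) * z" "sqrt p * (x * sqrt a + y * sqrt b)"]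
      by (simp only: mult.assoc)
    also have "(sqrt (q * c) * z)\<^sup>2 = q * c * z\<^sup>2" using q abc0 by (simp add: power_mult_distrib)
    also have "(sqrt p * (x * sqrt a + y * sqrt b))\<^sup>2 = p * (x * sqrt a + y * sqrt b)\<^sup>2"
      using p by (simp add: power_mult_distrib)
    also have "\<dots> \<le> p * ((a + b) * (x\<^sup>2 + y\<^sup>2))"
    proof -
      have "(a + b) * (x\<^sup>2 + y\<^sup>2) = ((sqrt a)\<^sup>2 + (sqrt b)\<^sup>2) * (x\<^sup>2 + y\<^sup>2)" using abc0 by simp
      \<comment> \<open>Lagrange's identity in two dimensions\<close>
      also have "\<dots> = (x * sqrt a + y * sqrt b)\<^sup>2 + (x * sqrt b - y * sqrt a)\<^sup>2"
        by (simp only: power2_eq_square) (simp add: algebra_simps)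
      finally show ?thesis using p by simp
    qed
    finally have "0 \<le> p * ((a + b) * (x\<^sup>2 + y\<^sup>2)) + q * c * z\<^sup>2 + 2 * (r * Re u + t * Re w)"
      using 1 by (simp add: algebra_simps)
    moreover have "r * (u + cnj u) + t * (w + cnj w) = complex_of_real (2 * (r * Re u + t * Re w))"
      by (simp add: complex_eq_iff)
    ultimately show "p * (X$1$1 + X$2$2) * (of_real ((cmod (v$1))\<^sup>2) + of_real ((cmod (v$2))\<^sup>2))
      + q * X$3$3 * of_real ((cmod (v$3))\<^sup>2)
      + (r * (cnj (v$1) * X$1$3 * v$3 + cnj (v$3) * X$3$1 * v$1)
       + t * (cnj (v$2) * X$3$2 * v$3 + cnj (v$3) * X$2$3 * v$2)) \<in> \<real>\<^sub>\<ge>\<^sub>0"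
      unfolding X1 u' w' u_def[symmetric] w_def[symmetric] xyz[symmetric]
      by (simp add: complex_nonneg_Reals_iff algebra_simps)
  qed
qed

lemma psd_rank_one:
  fixes u :: "complex^'n"
  shows "psd (\<chi> i j. u $ i * cnj (u $ j))"
  unfolding psd_def
proof
  fix v :: "complex^'n"
  define z where "z = (\<Sum>i\<in>UNIV. cnj (v $ i) * u $ i)"
  have "(\<Sum>i\<in>UNIV. cnj (v $ i) * ((\<chi> i j. u $ i * cnj (u $ j)) *v v) $ i) = z * cnj z"
    by (simp add: z_def matrix_vector_mult_def sum_product sum_distrib_left mult_ac) (rule sum.swap)
  then show "(\<Sum>i\<in>UNIV. cnj (v $ i) * ((\<chi> i j. u $ i * cnj (u $ j)) *v v) $ i) \<in> \<real>\<^sub>\<ge>\<^sub>0"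
    by (simp add: complex_norm_square[symmetric] del: of_real_power)
qed

text \<open>The test matrices \<open>u u\<^sup>*\<close> see either the \<open>r\<close>-entry or the \<open>t\<close>-entry of the image alone.\<close>

lemma Psi_positive_bounds:
  assumes "positive_map (Psi p q r t)"
  shows "r\<^sup>2 \<le> p * q" "t\<^sup>2 \<le> p * q"
proof -
  have P: "psd (Psi p q r t (\<chi> i j. u $ i * cnj (u $ j)))" for u
    using assms psd_rank_one unfolding positive_map_def by blast
  show "r\<^sup>2 \<le> p * q" using psd_entries(4)[OF P[of "vector [1,0,1]"], of 1 3] by (simp add: Psi_def)
  show "t\<^sup>2 \<le> p * q" using psd_entries(4)[OF P[of "vector [0,1,1]"], of 2 3] by (simp add: Psi_def)
qed

section \<open>Conjugations and the explicit splitting\<close>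

definition dagger :: "complex^'n^'m \<Rightarrow> complex^'m^'n" where
  "dagger K = (\<chi> i j. cnj (K $ j $ i))"

definition conjugation :: "complex^'n^'m \<Rightarrow> complex^'n^'n \<Rightarrow> complex^'m^'m" where
  "conjugation K X = K ** X ** dagger K"

lemma dagger_adjoint:
  "(\<Sum>i\<in>UNIV. cnj (u $ i) * (K *v w) $ i) = (\<Sum>i\<in>UNIV. cnj ((dagger K *v u) $ i) * w $ i)"
proof -
  have "(\<Sum>i\<in>UNIV. cnj (u $ i) * (K *v w) $ i) = (\<Sum>i\<in>UNIV. \<Sum>j\<in>UNIV. cnj (u $ i) * K $ i $ j * w $ j)"
    by (simp add: matrix_vector_mult_def sum_distrib_left mult_ac)
  also have "\<dots> = (\<Sum>j\<in>UNIV. \<Sum>i\<in>UNIV. cnj (u $ i) * K $ i $ j * w $ j)" by (rule sum.swap)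
  also have "\<dots> = (\<Sum>i\<in>UNIV. cnj ((dagger K *v u) $ i) * w $ i)"
    by (simp add: matrix_vector_mult_def dagger_def sum_distrib_left mult_ac)
  finally show ?thesis .
qed

lemma completely_positive_conjugation: "completely_positive (conjugation K)"
  unfolding completely_positive_def k_positive_def
proof (intro allI impI)
  fix k and X :: "nat \<Rightarrow> nat \<Rightarrow> complex^'a^'a"
  assume X: "block_psd k X"
  have "(\<Sum>i\<in>UNIV. cnj (v a $ i) * (conjugation K (X a b) *v v b) $ i)
    = (\<Sum>i\<in>UNIV. cnj ((dagger K *v v a) $ i) * (X a b *v (dagger K *v v b)) $ i)" for v :: "nat \<Rightarrow> complex^'b" and a b
    unfolding conjugation_def by (simp only: matrix_vector_mul_assoc[symmetric] dagger_adjoint[of "v a"])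
  then show "block_psd k (amplify (conjugation K) X)"
    using X[unfolded block_psd_def, THEN spec, of "\<lambda>a. dagger K *v v a" for v]
    by (simp only: block_psd_def amplify_def) blast
qed

lemma completely_positive_add:
  assumes "completely_positive \<Phi>" "completely_positive \<Psi>"
  shows "completely_positive (\<lambda>X. \<Phi> X + \<Psi> X)"
  using assms
  by (simp add: completely_positive_def k_positive_def block_psd_def amplify_def
      matrix_vector_mult_add_rdistrib algebra_simps sum.distrib nonneg_Reals_add_I)

lemma clinear_map_conjugation: "clinear_map (conjugation K)"
  by unfold_locales
    (simp_all add: conjugation_def cscale_def vec_eq_iff matrix_matrix_mult_def
      sum_distrib_left sum_distrib_right sum.distrib algebra_simps)

definition diag3 :: "complex \<Rightarrow> complex \<Rightarrow> complex \<Rightarrow> complex^3^3" where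
  "diag3 a b c = vector [vector [a, 0, 0], vector [0, b, 0], vector [0, 0, c]]"

text \<open>The splitting gives the \<open>r\<close>-entries to \<open>Psi_r\<close> and, after transposition, the \<open>t\<close>-entries to \<open>Psi_t\<close>.
A conjugation by a diagonal matrix has a rank one Choi matrix, so with \<open>p\<close> at the upper diagonal
entry and \<open>r\<close> off the diagonal the entry at \<open>(3, 3)\<close> has to be \<open>r\<^sup>2 / p\<close>: the cheapest share of \<open>q\<close>.
What remains, \<open>Psi_rest\<close>, takes diagonal values depending on the diagonal only; it is therefore unaffected by
transposition and can be put on either side.\<close>

definition Psi_r where
  "Psi_r p r = conjugation (diag3 (of_real (sqrt p)) 0 (of_real (r / sqrt p)))"

definition Psi_t where
  "Psi_t p t = conjugation (diag3 0 (of_real (sqrt p)) (of_real (t / sqrt p)))"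

definition Psi_rest where
  "Psi_rest p s X =
     conjugation (vector [vector [0, of_real (sqrt p), 0], 0, 0]) X
   + conjugation (vector [0, vector [of_real (sqrt p), 0, 0], 0]) X
   + conjugation (diag3 0 0 (of_real (sqrt s))) X"

lemma Psi_r_eq:
  assumes "p > 0"
  shows "Psi_r p r X = vector [vector [of_real p * X$1$1, 0, of_real r * X$1$3], 0,
     vector [of_real r * X$3$1, 0, of_real (r\<^sup>2 / p) * X$3$3]]"
proof -
  define s where "s = sqrt p"
  have s: "s > 0" "p = s * s" using assms by (auto simp: s_def)
  show ?thesis unfolding Psi_r_def s_def[symmetric] using s(1)
    by (simp add: s(2) conjugation_def dagger_def diag3_def matrix_matrix_mult_def
       vec_eq_iff forall_3 sum_3 power2_eq_square)
qed

lemma Psi_t_eq: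
  assumes "p > 0"
  shows "Psi_t p t X = vector [0, vector [0, of_real p * X$2$2, of_real t * X$2$3],
     vector [0, of_real t * X$3$2, of_real (t\<^sup>2 / p) * X$3$3]]"
proof -
  define s where "s = sqrt p"
  have s: "s > 0" "p = s * s" using assms by (auto simp: s_def)
  show ?thesis unfolding Psi_t_def s_def[symmetric] using s(1)
    by (simp add: s(2) conjugation_def dagger_def diag3_def matrix_matrix_mult_def
       vec_eq_iff forall_3 sum_3 power2_eq_square)
qed

lemma Psi_rest_eq:
  assumes "p \<ge> 0" "s \<ge> 0"
  shows "Psi_rest p s X = diag3 (of_real p * X$2$2) (of_real p * X$1$1) (of_real s * X$3$3)"
proof -
  define p' where "p' = sqrt p"
  have p: "p = p' * p'" using assms by (auto simp: p'_def)
  define s' where "s' = sqrt s"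
  have s: "s = s' * s'" using assms by (auto simp: s'_def)
  show ?thesis unfolding Psi_rest_def s'_def[symmetric] p'_def[symmetric]
    by (simp add: s p conjugation_def dagger_def diag3_def matrix_matrix_mult_def
       vec_eq_iff forall_3 sum_3)
qed

lemma completely_positive_parts:
  "completely_positive (Psi_r p r)" "completely_positive (Psi_t p t)" "completely_positive (Psi_rest p s)"
  unfolding Psi_r_def Psi_t_def Psi_rest_def
  by (intro completely_positive_add completely_positive_conjugation)+

lemma Psi_split:
  assumes p: "p > 0" and b: "r\<^sup>2 + t\<^sup>2 \<le> p * q"
  shows "Psi p q r t X = Psi_r p r X + transpose (Psi_t p t X + Psi_rest p (q - (r\<^sup>2 + t\<^sup>2) / p) X)"
proof -
  have "0 \<le> q - (r\<^sup>2 + t\<^sup>2) / p" using p b by (simp add: field_simps)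
  with p show ?thesis
    by (simp add: Psi_r_eq Psi_t_eq Psi_rest_eq Psi_def transpose_def diag3_def vec_eq_iff forall_3
        algebra_simps add_divide_distrib)
qed

text \<open>The hypothesis says that the coefficient \<open>q - (r\<^sup>2 + t\<^sup>2) / p\<close> left over for \<open>Psi_rest\<close> is nonnegative.\<close>

lemma Psi_decomposable:
  assumes p: "p > 0" and b: "r\<^sup>2 + t\<^sup>2 \<le> p * q"
  shows "decomposable (Psi p q r t)"
proof -
  let ?s = "q - (r\<^sup>2 + t\<^sup>2) / p"
  let ?\<Phi> = "\<lambda>X. transpose (Psi_t p t X + Psi_rest p ?s X)"
  have s: "0 \<le> ?s" using p b by (simp add: field_simps)
  have "clinear_map ?\<Phi>"
    by unfold_locales (use p s in \<open>simp_all add: Psi_t_eq Psi_rest_eq diag3_def cscale_def transpose_def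
        vec_eq_iff forall_3 algebra_simps\<close>)
  moreover have "completely_copositive ?\<Phi>"
    using completely_positive_add[OF completely_positive_parts(2,3)]
    by (simp add: completely_copositive_def comp_def)
  moreover have "clinear_map (Psi_r p r)" unfolding Psi_r_def by (rule clinear_map_conjugation)
  ultimately show ?thesis
    unfolding decomposable_def using completely_positive_parts(1) Psi_split[OF p b] by blast
qed

text \<open>The values of \<open>Psi_t p 0\<close> are diagonal matrices, hence unchanged by transposition, and the splitting
has only completely positive terms. The copositive case is the same with \<open>Psi_r p 0\<close>.\<close>

lemma Psi_completely_positive:
  assumes p: "p > 0" and b: "r\<^sup>2 \<le> p * q"
  shows "completely_positive (Psi p q r 0)"
proof -
  have s: "0 \<le> q - r\<^sup>2 / p" using p b by (simp add: field_simps)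
  have "Psi p q r 0 = (\<lambda>X. Psi_r p r X + (Psi_t p 0 X + Psi_rest p (q - r\<^sup>2 / p) X))"
    using p s by (auto simp add: Psi_r_eq Psi_t_eq Psi_rest_eq Psi_def diag3_def vec_eq_iff forall_3
        algebra_simps)
  then show ?thesis by (simp add: completely_positive_add completely_positive_parts)
qed

lemma Psi_completely_copositive:
  assumes p: "p > 0" and b: "t\<^sup>2 \<le> p * q"
  shows "completely_copositive (Psi p q 0 t)"
proof -
  have s: "0 \<le> q - t\<^sup>2 / p" using p b by (simp add: field_simps)
  have "transpose \<circ> Psi p q 0 t = (\<lambda>X. Psi_r p 0 X + (Psi_t p t X + Psi_rest p (q - t\<^sup>2 / p) X))"
    using p s by (auto simp add: Psi_r_eq Psi_t_eq Psi_rest_eq Psi_def diag3_def vec_eq_iff forall_3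
        algebra_simps transpose_def)
  then show ?thesis
    unfolding completely_copositive_def by (simp add: completely_positive_add completely_positive_parts)
qed

section \<open>Necessary conditions\<close>

lemma k_positive_zero: "k_positive k (\<lambda>X. 0 :: complex^'m^'m)"
  by (simp add: k_positive_def amplify_def block_psd_def)

lemma k_copositive_zero: "k_copositive k (\<lambda>X. 0 :: complex^'m^'m)"
  using k_positive_zero by (simp add: k_copositive_def comp_def transpose_def zero_vec_def)

lemma completely_positive_k_positive: "completely_positive \<Phi> \<Longrightarrow> k_positive k \<Phi>"
  by (simp add: completely_positive_def)

lemma completely_copositive_k_copositive: "completely_copositive \<Phi> \<Longrightarrow> k_copositive k \<Phi>"
  by (simp add: completely_copositive_def k_copositive_def completely_positive_def)

text \<open>A two-positive \<open>Psi\<close> is a splitting with zero copositive summand, which leaves no share of \<open>q\<close>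
for \<open>t\<close>; dually for a two-copositive \<open>Psi\<close> and \<open>r\<close>.\<close>

lemma Psi_two_positive_imp: "p > 0 \<Longrightarrow> k_positive 2 (Psi p q r t) \<Longrightarrow> t = 0"
  using Psi_two_decomposition_bounds(2)[of p _ "\<lambda>X. 0" q r t] k_copositive_zero by auto

lemma Psi_two_copositive_imp: "p > 0 \<Longrightarrow> k_copositive 2 (Psi p q r t) \<Longrightarrow> r = 0"
  using Psi_two_decomposition_bounds(1)[of p "\<lambda>X. 0" _ q r t] k_positive_zero by auto

lemma Psi_two_decomposition_imp:
  assumes "p > 0" "k_positive 2 \<Phi>1" "k_copositive 2 \<Phi>2" "Psi p q r t = (\<lambda>X. \<Phi>1 X + \<Phi>2 X)"
  shows "r\<^sup>2 + t\<^sup>2 \<le> p * q"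
proof -
  have "\<And>X. Psi p q r t X = \<Phi>1 X + \<Phi>2 X" using assms(4) by simp
  note Psi_two_decomposition_bounds[OF assms(1-3) this]
  then show ?thesis by (metis add_mono distrib_left)
qed

section \<open>The kernel\<close>

definition corner_traceless :: "(complex^3^3) set" where
  "corner_traceless = {X. X$1$1 + X$2$2 = 0 \<and> X$1$3 = 0 \<and> X$2$3 = 0 \<and> X$3$1 = 0 \<and> X$3$2 = 0 \<and> X$3$3 = 0}"

lemma map_kernel_Psi:
  assumes "p > 0" "q > 0" "r > 0" "t > 0"
  shows "map_kernel (Psi p q r t) = corner_traceless"
  using assms by (auto simp: map_kernel_def corner_traceless_def Psi_def vec_eq_iff forall_3
      of_real_eq_0_iff mult_eq_0_iff)

lemma subspace_corner_traceless: "cmat.subspace corner_traceless"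
  unfolding cmat.subspace_def
  by (auto simp: corner_traceless_def cscale_def ring_distribs[symmetric] algebra_simps
      add_eq_0_iff)

definition corner :: "complex^2^2 \<Rightarrow> complex^3^3" where
  "corner Z = vector [vector [Z$1$1, Z$1$2, 0], vector [Z$2$1, Z$2$2, 0], 0]"

definition std_frame :: "complex^2^3" where
  "std_frame = vector [vector [1, 0], vector [0, 1], 0]"

lemma corner_eq: "corner Z = std_frame ** Z ** transpose std_frame"
  by (simp add: corner_def std_frame_def matrix_matrix_mult_def transpose_def vec_eq_iff
      forall_3 sum_2)

lemma corner_traceless_eq_image: "corner_traceless = corner ` {Z. trace Z = 0}"
proof (intro equalityI subsetI)
  fix X assume X: "X \<in> corner_traceless"
  define Z :: "complex^2^2" where "Z = vector [vector [X$1$1, X$1$2], vector [X$2$1, X$2$2]]"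
  have "X = corner Z" "trace Z = 0"
    using X by (auto simp: corner_traceless_def corner_def Z_def trace_def vec_eq_iff forall_3 sum_2)
  then show "X \<in> corner ` {Z. trace Z = 0}" by blast
qed (auto simp: corner_traceless_def corner_def trace_def sum_2)

definition first_plane :: "(complex^3) set" where
  "first_plane = {u. u $ 3 = 0}"

lemma first_plane_dim: "vec.subspace first_plane" "vec.dim first_plane = 2"
proof -
  show "vec.subspace first_plane"
    by (auto simp: vec.subspace_def first_plane_def)
  let ?B = "{axis 1 1, axis 2 1} :: (complex^3) set"
  show "vec.dim first_plane = 2"
  proof (rule vec.dim_unique)
    show "?B \<subseteq> first_plane" by (auto simp: first_plane_def axis_def)
    show "first_plane \<subseteq> vec.span ?B"
    proof
      fix u assume u: "u \<in> first_plane"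
      have "u = u$1 *s axis 1 1 + u$2 *s axis 2 1"
        using u by (simp add: first_plane_def vec_eq_iff forall_3 axis_def)
      also have "\<dots> \<in> vec.span ?B"
        by (intro vec.span_add vec.span_scale vec.span_base) auto
      finally show "u \<in> vec.span ?B" .
    qed
    have "?B \<subseteq> {axis i 1 |i. i \<in> UNIV}" by auto
    then show "vec.independent ?B"
      using vec.independent_mono vec.independent_Basis[where 'a = complex] unfolding cart_basis_def by blast
    show "card ?B = 2" by (simp add: axis_eq_axis)
  qed
qed

lemma corner_traceless_eq:
  assumes "X \<in> corner_traceless"
  shows "X = cscale (X$1$1) (pure_tensor (axis 1 1) (axis 1 1) - pure_tensor (axis 2 1) (axis 2 1))
    + (cscale (X$1$2) (pure_tensor (axis 1 1) (axis 2 1)) + cscale (X$2$1) (pure_tensor (axis 2 1) (axis 1 1)))"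
  using assms
  by (auto simp: corner_traceless_def vec_eq_iff forall_3 pure_tensor_def axis_def cscale_def add_eq_0_iff)

lemma dim_corner_traceless: "cmat.dim corner_traceless = 3"
proof (rule cmat.dim_unique)
  let ?h = "pure_tensor (axis 1 1) (axis 1 1) - pure_tensor (axis 2 1) (axis 2 1) :: complex^3^3"
  let ?e = "pure_tensor (axis 1 1) (axis 2 1) :: complex^3^3"
  let ?f = "pure_tensor (axis 2 1) (axis 1 1) :: complex^3^3"
  let ?B = "{?h, ?e, ?f}"
  show "?B \<subseteq> corner_traceless"
    by (auto simp: corner_traceless_def pure_tensor_def axis_def)
  show "corner_traceless \<subseteq> cmat.span ?B"
  proof
    fix X assume "X \<in> corner_traceless"
    then show "X \<in> cmat.span ?B"
      by (subst corner_traceless_eq)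
        (assumption, intro cmat.span_add cmat.span_scale cmat.span_base, simp_all)
  qed
  have ne: "?h \<noteq> ?e" "?h \<noteq> ?f" "?e \<noteq> ?f"
    by (auto simp: vec_eq_iff pure_tensor_def axis_def forall_3)
  then show "card ?B = 3" by simp
  \<comment> \<open>Independence: the entry \<open>(1, 1)\<close> separates \<open>?h\<close> from the other two, the entry \<open>(1, 2)\<close>
    separates \<open>?e\<close> from \<open>?f\<close>.\<close>
  have sub: "cmat.subspace {X :: complex^3^3. X $ i $ j = 0}" for i j
    by (auto simp: cmat.subspace_def cscale_def)
  have "?f \<noteq> 0" by (simp add: vec_eq_iff pure_tensor_def axis_def forall_3)
  moreover have "?e \<notin> cmat.span {?f}"
    using cmat.span_minimal[OF _ sub[of 1 2], of "{?f}"]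
    by (auto simp: pure_tensor_def axis_def)
  moreover have "?h \<notin> cmat.span {?e, ?f}"
    using cmat.span_minimal[OF _ sub[of 1 1], of "{?e, ?f}"]
    by (auto simp: pure_tensor_def axis_def)
  ultimately show "cmat.independent ?B"
    using ne by (simp add: cmat.independent_insert cmat.independent_empty)
qed

lemma corner_traceless_subset_tensor: "corner_traceless \<subseteq> tensor_space first_plane first_plane"
proof
  fix X assume "X \<in> corner_traceless"
  moreover have "pure_tensor (axis i 1) (axis j 1) \<in> tensor_space first_plane first_plane"
    if "i \<noteq> 3" "j \<noteq> 3" for i j
    unfolding tensor_space_def using that
    by (intro cmat.span_base CollectI exI conjI refl) (auto simp: first_plane_def axis_def)
  ultimately show "X \<in> tensor_space first_plane first_plane"
    by (subst corner_traceless_eq) (auto simp: tensor_space_def intro!: cmat.span_add cmat.span_diff cmat.span_scale)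
qed

text \<open>Any frame of the plane differs from the standard one by a base change, namely its upper two-by-two
block \<open>C\<close>; the matrix \<open>A\<close> obtained here is the inverse of \<open>C\<close>.\<close>

lemma frame_of_first_plane:
  assumes "frame_of P first_plane"
  obtains A :: "complex^2^2" where "invertible A" "P ** A = std_frame"
proof -
  from assms have inj: "inj ((*v) P)" and ran: "range ((*v) P) = first_plane"
    by (auto simp: frame_of_def)
  define C :: "complex^2^2" where "C = vector [P$1, P$2]"
  have P3: "P$3 = 0"
  proof -
    have "(P *v axis j 1) $ 3 = 0" for j using ran by (auto simp: first_plane_def)
    then have "P $ 3 $ j = 0" for j
      by (simp add: matrix_vector_mult_def axis_def if_distrib cong: if_cong)
    then show ?thesis by (simp add: vec_eq_iff)
  qed
  have PC: "P = std_frame ** C"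
    by (simp add: vec_eq_iff forall_3 P3 std_frame_def C_def matrix_matrix_mult_def sum_2)
  have "inj ((*v) C)"
    using inj unfolding PC inj_def by (metis matrix_vector_mul_assoc)
  then have "invertible C"
    using matrix_left_invertible_injective[of C] invertible_left_inverse[of C] by simp
  then obtain A where A: "C ** A = mat 1" "A ** C = mat 1" by (auto simp: invertible_def)
  then have "invertible A" by (auto simp: invertible_def)
  moreover have "P ** A = std_frame" by (simp add: PC matrix_mul_assoc[symmetric] A)
  ultimately show thesis by (rule that)
qed

text \<open>After passing from arbitrary frames to the standard one, the pair \<open>A, B\<close> consists of the
two base changes, and the kernel is the traceless hyperplane on the nose.\<close>

lemma equiv_traceless_corner: "equiv_traceless first_plane first_plane corner_traceless"
  unfolding equiv_traceless_def
proof (intro allI impI)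
  fix P Q :: "complex^2^3"
  assume "frame_of P first_plane \<and> frame_of Q first_plane"
  then obtain A B where A: "invertible A" "P ** A = std_frame" and B: "invertible B" "Q ** B = std_frame"
    by (metis frame_of_first_plane)
  have "P ** (A ** Z ** transpose B) ** transpose Q = corner Z" for Z
  proof -
    have "P ** (A ** Z ** transpose B) ** transpose Q = (P ** A) ** Z ** transpose (Q ** B)"
      by (simp add: matrix_transpose_mul matrix_mul_assoc)
    then show ?thesis by (simp add: A B corner_eq)
  qed
  then show "\<exists>A B :: complex^2^2. invertible A \<and> invertible B \<and>
      corner_traceless = (\<lambda>Z. P ** (A ** Z ** transpose B) ** transpose Q) ` {Z. trace Z = 0}"
    using A B by (intro exI[of _ A] exI[of _ B]) (simp add: corner_traceless_eq_image)
qed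

section \<open>The rank one scheme of the kernel\<close>

lemma module_mpoly: "module ((*) :: mpoly33 \<Rightarrow> mpoly33 \<Rightarrow> mpoly33)"
  by unfold_locales (simp_all add: algebra_simps)

lemma ideal_generated_base: "f \<in> S \<Longrightarrow> f \<in> ideal_generated S"
  unfolding ideal_generated_def by (rule module.span_base[OF module_mpoly])

lemma ideal_generated_closed:
  shows ideal_generated_diff: "f \<in> ideal_generated S \<Longrightarrow> g \<in> ideal_generated S \<Longrightarrow> f - g \<in> ideal_generated S"
    and ideal_generated_mult: "f \<in> ideal_generated S \<Longrightarrow> h * f \<in> ideal_generated S"
    and ideal_generated_uminus: "f \<in> ideal_generated S \<Longrightarrow> - f \<in> ideal_generated S"
    and ideal_generated_zero: "0 \<in> ideal_generated S"
  unfolding ideal_generated_def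
  by (fact module.span_diff[OF module_mpoly] module.span_scale[OF module_mpoly]
      module.span_neg[OF module_mpoly] module.span_zero[OF module_mpoly])+

lemma ideal_generated_minimal: "S \<subseteq> ideal_generated T \<Longrightarrow> ideal_generated S \<subseteq> ideal_generated T"
  unfolding ideal_generated_def
  by (rule module.span_minimal[OF module_mpoly]) (auto intro: module.subspace_span[OF module_mpoly])

lemma eval_at_linear_term:
  "eval_at (Poly_Mapping.single (Poly_Mapping.single (i, j) 1) c) x = c * x $ i $ j"
proof -
  have "(\<Prod>(k, l)\<in>UNIV. (x $ k $ l) ^ Poly_Mapping.lookup (Poly_Mapping.single (i, j) (1::nat)) (k, l))
      = (\<Prod>kl\<in>UNIV. if kl = (i, j) then x $ i $ j else 1)"
    by (rule prod.cong) (auto simp: lookup_single when_def split: if_splits)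
  then show ?thesis by (simp add: eval_at_def)
qed

lemma mono_degree_single: "mono_degree (Poly_Mapping.single v n) = n"
  by (simp add: mono_degree_def lookup_single when_def)

lemma mono_degree_add: "mono_degree (m + m') = mono_degree m + mono_degree m'"
  by (simp add: mono_degree_def lookup_add sum.distrib)

lemma entry_var_vanishing:
  assumes "\<And>x. x \<in> K \<Longrightarrow> x $ i $ j = 0"
  shows "entry_var i j \<in> vanishing_linear_forms K"
  using assms eval_at_linear_term[of i j 1]
  by (simp add: vanishing_linear_forms_def homogeneous_def entry_var_def mono_degree_single)

definition corner_det :: mpoly33 where
  "corner_det = entry_var 1 1 * entry_var 2 2 - entry_var 1 2 * entry_var 2 1"

text \<open>Modulo the coordinates in the third row and column, every two-by-two minor is zero or, up to sign,
the minor of the upper left corner. So the two ideals agree already before saturation.\<close>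

lemma rank_one_scheme_corner:
  "rank_one_scheme corner_traceless
    = ideal_generated (vanishing_linear_forms corner_traceless \<union> {corner_det})"
  (is "_ = ?J")
proof
  have border: "entry_var i j \<in> ?J" if "i = 3 \<or> j = 3" for i j
  proof (rule ideal_generated_base, rule UnI1, rule entry_var_vanishing)
    fix x assume "x \<in> corner_traceless"
    then show "x $ i $ j = 0"
      using that exhaust_3[of i] exhaust_3[of j] by (auto simp: corner_traceless_def)
  qed
  have F: "corner_det \<in> ?J" by (rule ideal_generated_base) simp
  have right: "f * h \<in> ?J" if "f \<in> ?J" for f h
    using ideal_generated_mult[OF that, of h] by (simp only: mult.commute)
  have minor: "entry_var i j * entry_var k l - entry_var i l * entry_var k j \<in> ?J" for i j k l
  proof -
    consider "i = 3" | "j = 3" | "k = 3" | "l = 3" | "i = k" | "j = l"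
      | "i \<noteq> 3" "j \<noteq> 3" "k \<noteq> 3" "l \<noteq> 3" "i \<noteq> k" "j \<noteq> l" by blast
    then show ?thesis
    proof cases
      case 7
      then have "entry_var i j * entry_var k l - entry_var i l * entry_var k j \<in> {corner_det, - corner_det}"
        using exhaust_3[of i] exhaust_3[of j] exhaust_3[of k] exhaust_3[of l]
        by (auto simp: corner_det_def mult.commute)
      then show ?thesis using F ideal_generated_uminus[OF F] by auto
    next
      case 1
      then show ?thesis by (intro ideal_generated_diff right border) auto
    next
      case 2
      show ?thesis
        by (intro ideal_generated_diff right[of "entry_var i j"] ideal_generated_mult[of "entry_var k j"] border)
          (use 2 in auto)
    next
      case 3
      then show ?thesis by (intro ideal_generated_diff ideal_generated_mult border) auto
    next
      case 4
      show ?thesis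
        by (intro ideal_generated_diff right[of "entry_var i l"] ideal_generated_mult[of "entry_var k l"] border)
          (use 4 in auto)
    next
      case 5
      then show ?thesis by (simp add: mult.commute ideal_generated_zero)
    next
      case 6
      then show ?thesis by (simp add: ideal_generated_zero)
    qed
  qed
  show "rank_one_scheme corner_traceless \<subseteq> ?J"
    unfolding rank_one_scheme_def
    using minor by (intro ideal_generated_minimal) (auto simp: segre_minors_def intro: ideal_generated_base)
  have "corner_det \<in> segre_minors"
    unfolding segre_minors_def corner_det_def by blast
  then show "?J \<subseteq> rank_one_scheme corner_traceless"
    unfolding rank_one_scheme_def
    by (intro ideal_generated_minimal) (auto intro: ideal_generated_base)
qed

lemma corner_det_eq:
  "corner_det = Poly_Mapping.single (Poly_Mapping.single (1, 1) 1 + Poly_Mapping.single (2, 2) 1) 1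
    - Poly_Mapping.single (Poly_Mapping.single (1, 2) 1 + Poly_Mapping.single (2, 1) 1) 1"
  by (simp add: corner_det_def entry_var_def mult_single)

lemma corner_det_monomials:
  defines "m1 \<equiv> Poly_Mapping.single (1, 1) 1 + Poly_Mapping.single (2, 2) 1 :: (3 \<times> 3) \<Rightarrow>\<^sub>0 nat"
    and "m2 \<equiv> Poly_Mapping.single (1, 2) 1 + Poly_Mapping.single (2, 1) 1 :: (3 \<times> 3) \<Rightarrow>\<^sub>0 nat"
  shows "m1 \<noteq> m2" "Poly_Mapping.keys corner_det = {m1, m2}"
    "Poly_Mapping.lookup corner_det m1 = 1" "Poly_Mapping.lookup corner_det m2 = -1"
proof -
  have "Poly_Mapping.lookup m1 (1, 1) \<noteq> Poly_Mapping.lookup m2 (1, 1)"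
    by (simp add: m1_def m2_def lookup_add lookup_single)
  then show ne: "m1 \<noteq> m2" by auto
  have l: "Poly_Mapping.lookup corner_det m = (if m = m1 then 1 else if m = m2 then -1 else 0)" for m
    using ne unfolding corner_det_eq m1_def[symmetric] m2_def[symmetric]
    by (auto simp: lookup_minus lookup_single when_def)
  then show "Poly_Mapping.keys corner_det = {m1, m2}"
    by (auto simp: in_keys_iff split: if_splits)
  show "Poly_Mapping.lookup corner_det m1 = 1" "Poly_Mapping.lookup corner_det m2 = -1"
    using l ne by auto
qed

lemma homogeneous_corner_det: "homogeneous 2 corner_det"
  by (simp add: homogeneous_def corner_det_monomials mono_degree_add mono_degree_single)

text \<open>Each partial derivative of the determinant is a single signed coordinate, because the exponent
vectors of its two monomials have disjoint supports.\<close>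

lemma eval_at_partial_corner_det:
  "eval_at (partial_deriv i j corner_det) x =
    (if (i, j) = (1, 1) then x$2$2 else if (i, j) = (2, 2) then x$1$1
     else if (i, j) = (1, 2) then - x$2$1 else if (i, j) = (2, 1) then - x$1$2 else 0)"
proof -
  have z: "eval_at 0 x = 0" by (simp add: eval_at_def)
  have ij: "(i = 1 \<or> i = 2 \<or> i = 3) \<and> (j = 1 \<or> j = 2 \<or> j = 3)" using exhaust_3 by blast
  show ?thesis
    using ij corner_det_monomials(1)
    unfolding partial_deriv_def corner_det_monomials(2)
    by (auto simp: corner_det_monomials(3,4)[simplified] lookup_add lookup_single z eval_at_linear_term[simplified])
qed

text \<open>On traceless matrices the determinant is a nondegenerate quadratic form, so its differential along
the space vanishes at the origin only.\<close>

lemma smooth_conic_corner: "smooth_conic (rank_one_scheme corner_traceless)"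
  unfolding smooth_conic_def
proof (intro exI conjI ballI impI)
  show "cmat.subspace corner_traceless" by (rule subspace_corner_traceless)
  show "cmat.dim corner_traceless = 3" by (rule dim_corner_traceless)
  show "homogeneous 2 corner_det" by (rule homogeneous_corner_det)
  show "same_subscheme (rank_one_scheme corner_traceless)
     (ideal_generated (vanishing_linear_forms corner_traceless \<union> {corner_det}))"
    by (simp add: same_subscheme_def rank_one_scheme_corner)
  fix x assume x: "x \<in> corner_traceless" and "x \<noteq> 0 \<and> eval_at corner_det x = 0"
  then have nz: "x$1$1 \<noteq> 0 \<or> x$1$2 \<noteq> 0 \<or> x$2$1 \<noteq> 0"
    by (auto simp: corner_traceless_def vec_eq_iff forall_3)
  have d: "(\<Sum>i\<in>UNIV. \<Sum>j\<in>UNIV. eval_at (partial_deriv i j corner_det) x * w $ i $ j)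
     = x$2$2 * w$1$1 + x$1$1 * w$2$2 - x$2$1 * w$1$2 - x$1$2 * w$2$1" for w :: "complex^3^3"
    by (simp add: eval_at_partial_corner_det sum_3)
  \<comment> \<open>The conjugate of the gradient of the determinant at \<open>x\<close>, so that the differential at \<open>w\<close>
    becomes a sum of squared moduli.\<close>
  define w where "w = corner (vector [vector [- cnj (x$1$1), - cnj (x$2$1)], vector [- cnj (x$1$2), cnj (x$1$1)]])"
  have "w \<in> corner_traceless"
    by (simp add: w_def corner_traceless_def corner_def)
  moreover have "x$2$2 * w$1$1 + x$1$1 * w$2$2 - x$2$1 * w$1$2 - x$1$2 * w$2$1 \<noteq> 0"
  proof -
    have x22: "x$2$2 = - x$1$1" using x by (simp add: corner_traceless_def add_eq_0_iff)
    have "x$2$2 * w$1$1 + x$1$1 * w$2$2 - x$2$1 * w$1$2 - x$1$2 * w$2$1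
      = of_real (2 * (cmod (x$1$1))\<^sup>2 + (cmod (x$2$1))\<^sup>2 + (cmod (x$1$2))\<^sup>2)"
      unfolding of_real_add of_real_mult complex_norm_square
      by (simp add: x22 w_def corner_def)
    moreover have "2 * (cmod (x$1$1))\<^sup>2 + (cmod (x$2$1))\<^sup>2 + (cmod (x$1$2))\<^sup>2 > 0"
    proof -
      have "(cmod (x$1$1))\<^sup>2 > 0 \<or> (cmod (x$2$1))\<^sup>2 > 0 \<or> (cmod (x$1$2))\<^sup>2 > 0" using nz by auto
      then show ?thesis by (smt (verit) zero_le_power2)
    qed
    ultimately show ?thesis by (metis of_real_eq_0_iff less_irrefl)
  qed
  ultimately show "\<exists>w\<in>corner_traceless. (\<Sum>i\<in>UNIV. \<Sum>j\<in>UNIV. eval_at (partial_deriv i j corner_det) x * w $ i $ j) \<noteq> 0"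
    unfolding d by blast
qed

section \<open>The classification\<close>

theorem theorem1p4:
  fixes p q r t :: real
  assumes "p > 0" and "q > 0" and "r \<ge> 0" and "t \<ge> 0"
  shows "(positive_map (Psi p q r t) \<longleftrightarrow> r\<^sup>2 \<le> p * q \<and> t\<^sup>2 \<le> p * q) \<and>
    (r\<^sup>2 \<le> p * q \<and> t\<^sup>2 \<le> p * q \<longrightarrow>
       (decomposable (Psi p q r t) \<longleftrightarrow> r\<^sup>2 + t\<^sup>2 \<le> p * q) \<and>
       (r\<^sup>2 + t\<^sup>2 > p * q \<longrightarrow> atomic_map (Psi p q r t)) \<and>
       (k_positive 2 (Psi p q r t) \<longleftrightarrow> completely_positive (Psi p q r t)) \<and>
       (k_positive 2 (Psi p q r t) \<longleftrightarrow> t = 0) \<and>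
       (k_copositive 2 (Psi p q r t) \<longleftrightarrow> completely_copositive (Psi p q r t)) \<and>
       (k_copositive 2 (Psi p q r t) \<longleftrightarrow> r = 0)) \<and>
    (r > 0 \<and> t > 0 \<longrightarrow>
       cmat.subspace (map_kernel (Psi p q r t)) \<and>
       cmat.dim (map_kernel (Psi p q r t)) = 3 \<and>
       (\<exists>U V. vec.subspace U \<and> vec.dim U = 2 \<and> vec.subspace V \<and> vec.dim V = 2 \<and>
          map_kernel (Psi p q r t) \<subseteq> tensor_space U V \<and>
          equiv_traceless U V (map_kernel (Psi p q r t))) \<and>
       smooth_conic (rank_one_scheme (map_kernel (Psi p q r t))))"
proof -
  let ?\<Psi> = "Psi p q r t"
  have positive: "positive_map ?\<Psi> \<longleftrightarrow> r\<^sup>2 \<le> p * q \<and> t\<^sup>2 \<le> p * q"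
    using assms Psi_positive Psi_positive_bounds by blast
  have no_split: "r\<^sup>2 + t\<^sup>2 \<le> p * q"
    if "k_positive 2 \<Phi>1" "k_copositive 2 \<Phi>2" "?\<Psi> = (\<lambda>X. \<Phi>1 X + \<Phi>2 X)" for \<Phi>1 \<Phi>2
    using Psi_two_decomposition_imp[OF assms(1) that] .
  have decomposable: "decomposable ?\<Psi> \<longleftrightarrow> r\<^sup>2 + t\<^sup>2 \<le> p * q"
  proof
    assume "decomposable ?\<Psi>"
    then obtain \<Phi>1 \<Phi>2 where "completely_positive \<Phi>1" "completely_copositive \<Phi>2"
      and eq: "?\<Psi> = (\<lambda>X. \<Phi>1 X + \<Phi>2 X)"
      unfolding decomposable_def by blast
    then show "r\<^sup>2 + t\<^sup>2 \<le> p * q"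
      using no_split[OF _ _ eq] completely_positive_k_positive completely_copositive_k_copositive by blast
  qed (rule Psi_decomposable[OF assms(1)])
  have atomic: "atomic_map ?\<Psi>" if "r\<^sup>2 \<le> p * q" "t\<^sup>2 \<le> p * q" "r\<^sup>2 + t\<^sup>2 > p * q"
    unfolding atomic_map_def using positive that no_split by (meson not_le)
  have two_positive: "k_positive 2 ?\<Psi> \<longleftrightarrow> t = 0" "k_positive 2 ?\<Psi> \<longleftrightarrow> completely_positive ?\<Psi>"
    if "r\<^sup>2 \<le> p * q"
    using Psi_two_positive_imp[OF assms(1)] Psi_completely_positive[OF assms(1) that]
      completely_positive_k_positive by blast+
  have two_copositive: "k_copositive 2 ?\<Psi> \<longleftrightarrow> r = 0" "k_copositive 2 ?\<Psi> \<longleftrightarrow> completely_copositive ?\<Psi>"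
    if "t\<^sup>2 \<le> p * q"
    using Psi_two_copositive_imp[OF assms(1)] Psi_completely_copositive[OF assms(1) that]
      completely_copositive_k_copositive by blast+
  have kernel: "map_kernel ?\<Psi> = corner_traceless" if "r > 0 \<and> t > 0"
    using map_kernel_Psi assms that by blast
  have plane: "\<exists>U V. vec.subspace U \<and> vec.dim U = 2 \<and> vec.subspace V \<and> vec.dim V = 2 \<and>
      corner_traceless \<subseteq> tensor_space U V \<and> equiv_traceless U V corner_traceless"
    using first_plane_dim corner_traceless_subset_tensor equiv_traceless_corner by blast
  have geometry: "cmat.subspace (map_kernel ?\<Psi>) \<and> cmat.dim (map_kernel ?\<Psi>) = 3 \<and>
      (\<exists>U V. vec.subspace U \<and> vec.dim U = 2 \<and> vec.subspace V \<and> vec.dim V = 2 \<and>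
         map_kernel ?\<Psi> \<subseteq> tensor_space U V \<and> equiv_traceless U V (map_kernel ?\<Psi>)) \<and>
      smooth_conic (rank_one_scheme (map_kernel ?\<Psi>))" if "r > 0 \<and> t > 0"
    unfolding kernel[OF that]
    by (intro conjI plane subspace_corner_traceless dim_corner_traceless smooth_conic_corner)
  from positive decomposable atomic two_positive two_copositive geometry show ?thesis by metis
qed

end
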